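(* For an integer $k \geq 2$ let $$f_k(x_1,\ldots,x_k) = \prod_{1 \leq i < j \leq k} (x_j - x_i) \prod_{2 \leq i < j \leq k} (x_i + x_{i+1} + \cdots + x_j) \in \mathbb{Z}[x_1,\ldots,x_k],$$ a homogeneous polynomial of degree $(k-1)^2$. Fix an integer $d > 3$. Then for all but at most $(d-3)(d-2)(d-1)/6$ integers $k$ with $k > \max(d-1, d^2/8)$, the polynomial $f_k$ has a monomial of degree $(k-1)^2$ with nonzero integer coefficient in which every variable has exponent at most $2k-d-1$. Consequently, for each such non-exceptional $k$ there is a finite set $P_k$ of primes such that for every prime $p \notin P_k$ and every set $S$ of $2k-d$ distinct elements of $\mathbb{Z}_p \setminus \{0\}$, there exist pairwise distinct $a_1,\ldots,a_k \in S$ whose partial sums $s_j = a_1 + \cdots + a_j$ ($1 \leq j \leq k$) are pairwise distinct.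
   Context: $\mathbb{Z}_p$ denotes the integers modulo $p$. *)

theory Defs
  imports Complex_Main "HOL-Library.Poly_Mapping" "HOL-Number_Theory.Residues"
begin

text \<open>
  A monomial is the finitely supported map sending the index of each variable to its exponent.
  A polynomial is the finitely supported map sending each monomial to its coefficient, so
  multiplication is the convolution product of \<^theory>\<open>HOL-Library.Poly_Mapping\<close> and
  \<open>Poly_Mapping.lookup P m\<close> is the coefficient of the monomial \<open>m\<close> in \<open>P\<close>.
\<close>

type_synonym monom = "nat \<Rightarrow>\<^sub>0 nat"
type_synonym int_mpoly = "monom \<Rightarrow>\<^sub>0 int"

definition var :: "nat \<Rightarrow> int_mpoly" where
  "var i = Poly_Mapping.single (Poly_Mapping.single i 1) 1"

definition mdegree :: "monom \<Rightarrow> nat" where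
  "mdegree m = (\<Sum>i\<in>Poly_Mapping.keys m. Poly_Mapping.lookup m i)"

definition homogeneous_of_degree :: "nat \<Rightarrow> int_mpoly \<Rightarrow> bool" where
  "homogeneous_of_degree n P \<longleftrightarrow> P \<noteq> 0 \<and> (\<forall>m\<in>Poly_Mapping.keys P. mdegree m = n)"

definition f_poly :: "nat \<Rightarrow> int_mpoly" where
  "f_poly k = (\<Prod>(i, j)\<in>{(i, j). 1 \<le> i \<and> i < j \<and> j \<le> k}. var j - var i)
            * (\<Prod>(i, j)\<in>{(i, j). 2 \<le> i \<and> i < j \<and> j \<le> k}. \<Sum>l\<in>{i..j}. var l)"

definition has_monomial_bounded :: "int_mpoly \<Rightarrow> nat \<Rightarrow> nat \<Rightarrow> bool" where
  "has_monomial_bounded P n e \<longleftrightarrow>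
     (\<exists>m. mdegree m = n \<and> Poly_Mapping.lookup P m \<noteq> 0 \<and> (\<forall>i. Poly_Mapping.lookup m i \<le> e))"

definition admits_distinct_partial_sums :: "nat \<Rightarrow> nat \<Rightarrow> int set \<Rightarrow> bool" where
  "admits_distinct_partial_sums p k S \<longleftrightarrow>
     (\<exists>a :: nat \<Rightarrow> int. a ` {1..k} \<subseteq> S \<and> inj_on a {1..k} \<and>
        inj_on (\<lambda>j. \<Oplus>\<^bsub>residue_ring (int p)\<^esub>i\<in>{1..j}. a i) {1..k})"

end

theory Submission
  imports Defs "HOL-Computational_Algebra.Polynomial"
begin

text \<open>
  Put \<open>z = d - 1\<close>, \<open>n = k - z\<close> and \<open>S\<^sub>i = x\<^sub>i + ... + x\<^sub>z\<close>. Choose weights for which \<open>x\<^sub>1\<close> dominates,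
  \<open>x\<^sub>2, ..., x\<^sub>z\<close> are tied and \<open>x\<^bsub>z+1\<^esub>, ..., x\<^sub>k\<close> decrease. The leading form of \<open>f\<^sub>k\<close> is then, up to sign, a
  monomial times \<open>B \<Prod>i=2..z. S\<^sub>i ^ n\<close>, where \<open>B = \<Prod>(x\<^sub>j - x\<^sub>i)(x\<^sub>i + ... + x\<^sub>j)\<close> over \<open>2 \<le> i < j \<le> z\<close> does not
  depend on \<open>k\<close>. The monomial giving each of \<open>x\<^sub>2, ..., x\<^sub>z\<close> the exponent \<open>2k - d - 1\<close> therefore has as
  coefficient, up to sign, the coefficient \<open>Q n\<close> of \<open>\<Prod>i=2..z. x\<^sub>i ^ (n + d - 3)\<close> in \<open>B \<Prod> S\<^sub>i ^ n\<close>.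

  A monomial \<open>\<beta>\<close> of \<open>B\<close> contributes to \<open>Q n\<close> a product of binomial coefficients, which is zero or a
  polynomial in \<open>n\<close> of degree \<open>\<Sum>j. (z + 1 - j)(\<beta>\<^sub>j - (d - 3))\<close>. This degree is largest for exactly one
  monomial, \<open>\<beta>\<^sub>j = 2(z - j)\<close>, whose contribution is nonzero. So \<open>Q\<close> is a nonzero polynomial of degree
  \<open>(d-3)(d-2)(d-1)/6\<close>, and the exceptional \<open>k\<close> are among its roots. The statement on partial sums is
  the combinatorial Nullstellensatz modulo primes not dividing the coefficient.
\<close>

section \<open>Leading forms with respect to a weight\<close>

definition wt :: "(nat \<Rightarrow> nat) \<Rightarrow> monom \<Rightarrow> nat" where
  "wt w m = (\<Sum>i\<in>Poly_Mapping.keys m. w i * Poly_Mapping.lookup m i)"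

lemma wt_superset:
  assumes "finite A" "Poly_Mapping.keys m \<subseteq> A"
  shows "wt w m = (\<Sum>i\<in>A. w i * Poly_Mapping.lookup m i)"
  unfolding wt_def by (rule sum.mono_neutral_left) (use assms in \<open>auto simp: in_keys_iff\<close>)

lemma wt_0 [simp]: "wt w 0 = 0"
  by (simp add: wt_def)

lemma wt_add: "wt w (m + m') = wt w m + wt w m'"
proof -
  let ?A = "Poly_Mapping.keys m \<union> Poly_Mapping.keys m'"
  have "wt w (m + m') = (\<Sum>i\<in>?A. w i * Poly_Mapping.lookup (m + m') i)"
    by (rule wt_superset) (auto simp: Poly_Mapping.keys_add)
  also have "\<dots> = (\<Sum>i\<in>?A. w i * Poly_Mapping.lookup m i) + (\<Sum>i\<in>?A. w i * Poly_Mapping.lookup m' i)"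
    by (simp add: lookup_add algebra_simps sum.distrib)
  also have "\<dots> = wt w m + wt w m'"
    by (simp flip: wt_superset)
  finally show ?thesis .
qed

lemma wt_single [simp]: "wt w (Poly_Mapping.single i c) = w i * c"
  by (simp add: wt_def)

lemma mdegree_eq_wt: "mdegree m = wt (\<lambda>_. 1) m"
  by (simp add: mdegree_def wt_def)

definition whomog :: "(nat \<Rightarrow> nat) \<Rightarrow> nat \<Rightarrow> int_mpoly \<Rightarrow> bool" where
  "whomog w N P \<longleftrightarrow> (\<forall>m\<in>Poly_Mapping.keys P. wt w m = N)"

definition wsmall :: "(nat \<Rightarrow> nat) \<Rightarrow> nat \<Rightarrow> int_mpoly \<Rightarrow> bool" where
  "wsmall w N P \<longleftrightarrow> (\<forall>m\<in>Poly_Mapping.keys P. wt w m < N)"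

text \<open>The degree \<open>N\<close> is a parameter because the zero polynomial is homogeneous of
  every degree. \<open>T\<close> may consist of several tied terms, and products need no check that
  \<open>T\<close> is nonzero.\<close>

definition leading_form :: "(nat \<Rightarrow> nat) \<Rightarrow> nat \<Rightarrow> int_mpoly \<Rightarrow> int_mpoly \<Rightarrow> bool" where
  "leading_form w N P T \<longleftrightarrow> whomog w N T \<and> wsmall w N (P - T)"

lemma keys_multE:
  fixes P Q :: int_mpoly
  assumes "m \<in> Poly_Mapping.keys (P * Q)"
  obtains a b where "a \<in> Poly_Mapping.keys P" "b \<in> Poly_Mapping.keys Q" "m = a + b"
  using assms Poly_Mapping.keys_mult[of P Q] by blast

lemma whomog_1: "whomog w 0 1"
  by (simp add: whomog_def)

lemma whomog_mult: "whomog w N P \<Longrightarrow> whomog w M Q \<Longrightarrow> whomog w (N + M) (P * Q)"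
  unfolding whomog_def by (metis keys_multE wt_add)

lemma whomog_sum: "(\<And>x. x \<in> A \<Longrightarrow> whomog w N (f x)) \<Longrightarrow> whomog w N (sum f A)"
  unfolding whomog_def using Poly_Mapping.keys_sum[of f A] by blast

lemma whomog_power: "whomog w N P \<Longrightarrow> whomog w (n * N) (P ^ n)"
  by (induction n) (auto simp: whomog_1 intro: whomog_mult)

lemma whomog_prod:
  "(\<And>x. x \<in> A \<Longrightarrow> whomog w (N x) (f x)) \<Longrightarrow> whomog w (sum N A) (prod f A)"
  by (induction A rule: infinite_finite_induct) (auto simp: whomog_1 intro: whomog_mult)

lemma whomog_uminus [simp]: "whomog w N (- P) \<longleftrightarrow> whomog w N P"
  by (simp add: whomog_def)

lemma whomog_diff: "whomog w N P \<Longrightarrow> whomog w N Q \<Longrightarrow> whomog w N (P - Q)"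
  unfolding whomog_def using Poly_Mapping.keys_diff[of P Q] by blast

lemma whomog_single: "wt w m = N \<Longrightarrow> whomog w N (Poly_Mapping.single m c)"
  by (simp add: whomog_def)

lemma whomog_var: "w i = N \<Longrightarrow> whomog w N (var i)"
  unfolding var_def by (rule whomog_single) simp

lemma wsmall_0 [simp]: "wsmall w N 0"
  by (simp add: wsmall_def)

lemma wsmall_add: "wsmall w N P \<Longrightarrow> wsmall w N Q \<Longrightarrow> wsmall w N (P + Q)"
  unfolding wsmall_def using Poly_Mapping.keys_add[of P Q] by blast

lemma wsmall_sum: "(\<And>x. x \<in> A \<Longrightarrow> wsmall w N (f x)) \<Longrightarrow> wsmall w N (sum f A)"
  by (induction A rule: infinite_finite_induct) (auto intro: wsmall_add)

lemma whomog_imp_wsmall: "whomog w M P \<Longrightarrow> M < N \<Longrightarrow> wsmall w N P"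
  by (auto simp: whomog_def wsmall_def)

lemma wsmall_mult_whomog: "wsmall w N P \<Longrightarrow> whomog w M Q \<Longrightarrow> wsmall w (N + M) (P * Q)"
  unfolding whomog_def wsmall_def by (metis keys_multE wt_add add_less_mono1)

lemma wsmall_mult: "wsmall w N P \<Longrightarrow> wsmall w M Q \<Longrightarrow> wsmall w (N + M) (P * Q)"
  unfolding wsmall_def by (metis keys_multE wt_add add_strict_mono)

lemma leading_form_1: "leading_form w 0 1 1"
  by (simp add: leading_form_def whomog_1)

text \<open>Every term in the expansion of the error around \<open>T * U\<close> has a factor
  \<open>P - T\<close> or \<open>Q - U\<close>, which pushes its weight strictly below
  \<open>N + M\<close>.\<close>

lemma leading_form_mult:
  assumes "leading_form w N P T" "leading_form w M Q U"
  shows "leading_form w (N + M) (P * Q) (T * U)"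
proof -
  have "P * Q - T * U = (P - T) * (Q - U) + (P - T) * U + (Q - U) * T"
    by (simp add: algebra_simps)
  moreover have "wsmall w (N + M) ((P - T) * (Q - U))" "wsmall w (N + M) ((P - T) * U)"
    "wsmall w (M + N) ((Q - U) * T)"
    using assms by (auto simp: leading_form_def intro: wsmall_mult wsmall_mult_whomog)
  ultimately have "wsmall w (N + M) (P * Q - T * U)"
    by (simp add: add.commute wsmall_add)
  thus ?thesis
    using assms by (auto simp: leading_form_def intro: whomog_mult)
qed

lemma leading_form_prod:
  "(\<And>x. x \<in> A \<Longrightarrow> leading_form w (N x) (f x) (g x)) \<Longrightarrow> leading_form w (sum N A) (prod f A) (prod g A)"
  by (induction A rule: infinite_finite_induct) (auto simp: leading_form_1 intro: leading_form_mult)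

lemma leading_form_var_diff:
  "w j < w i \<Longrightarrow> leading_form w (w i) (var j - var i) (- var i)"
  by (auto simp: leading_form_def whomog_var intro: whomog_imp_wsmall[where M = "w j"])

lemma leading_form_self: "whomog w N P \<Longrightarrow> leading_form w N P P"
  by (simp add: leading_form_def)

lemma leading_form_sum_var:
  assumes "finite A" "B \<subseteq> A" "\<And>i. i \<in> B \<Longrightarrow> w i = N" "\<And>i. i \<in> A - B \<Longrightarrow> w i < N"
  shows "leading_form w N (\<Sum>i\<in>A. var i) (\<Sum>i\<in>B. var i)"
proof -
  have "(\<Sum>i\<in>A. var i) - (\<Sum>i\<in>B. var i) = (\<Sum>i\<in>A - B. var i)"
    using assms by (simp add: sum_diff)
  moreover have "wsmall w N (var i)" if "i \<in> A - B" for i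
    using assms(4)[OF that] by (auto intro: whomog_imp_wsmall whomog_var)
  ultimately show ?thesis
    using assms by (auto simp: leading_form_def intro!: wsmall_sum whomog_sum whomog_var)
qed

text \<open>Monomials of \<open>T\<close> have weight \<open>N\<close> and those of
  \<open>P - T\<close> weigh less, so nothing cancels. A nonzero coefficient can thus be computed in
  the leading form alone.\<close>

lemma leading_form_lookup:
  assumes "leading_form w N P T" "Poly_Mapping.lookup T m \<noteq> 0"
  shows "Poly_Mapping.lookup P m = Poly_Mapping.lookup T m"
proof -
  have "m \<notin> Poly_Mapping.keys (P - T)"
    using assms by (fastforce simp: leading_form_def whomog_def wsmall_def in_keys_iff)
  thus ?thesis
    by (simp add: in_keys_iff lookup_minus)
qed

lemma leading_form_single_less:
  assumes "leading_form w N P (c * Poly_Mapping.single m0 1)" "m \<in> Poly_Mapping.keys P" "m \<noteq> m0"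
    and "c = 1 \<or> c = -1"
  shows "wt w m < wt w m0"
proof -
  have "whomog w N (Poly_Mapping.single m0 1)"
    using assms by (auto simp: leading_form_def)
  hence "wt w m0 = N" by (simp add: whomog_def)
  moreover have "Poly_Mapping.lookup (c * Poly_Mapping.single m0 1) m = 0"
    using assms(3,4) by (auto simp: lookup_single)
  hence "m \<in> Poly_Mapping.keys (P - c * Poly_Mapping.single m0 1)"
    using assms(2) by (simp add: in_keys_iff lookup_minus)
  ultimately show ?thesis using assms(1) by (auto simp: leading_form_def wsmall_def)
qed

lemma mpoly_expand: "P = (\<Sum>m\<in>Poly_Mapping.keys P. Poly_Mapping.single m (Poly_Mapping.lookup P m))"
  for P :: int_mpoly
  by (rule poly_mapping_eqI) (simp add: lookup_sum lookup_single when_def in_keys_iff)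

lemma lookup_single_mult:
  "Poly_Mapping.lookup (Poly_Mapping.single u 1 * P :: int_mpoly) (u + v) = Poly_Mapping.lookup P v"
proof -
  have "Poly_Mapping.single u 1 * P =
    (\<Sum>m\<in>Poly_Mapping.keys P. Poly_Mapping.single (u + m) (Poly_Mapping.lookup P m))"
    by (subst mpoly_expand[of P]) (simp add: sum_distrib_left mult_single)
  thus ?thesis
    by (simp add: lookup_sum lookup_single when_def in_keys_iff)
qed

lemma lookup_of_nat_mult:
  "Poly_Mapping.lookup (of_nat c * P :: int_mpoly) m = of_nat c * Poly_Mapping.lookup P m"
  by (induction c) (simp_all add: algebra_simps lookup_add)

lemma lookup_of_int_mult:
  "Poly_Mapping.lookup (of_int c * P :: int_mpoly) m = of_int c * Poly_Mapping.lookup P m"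
  by (cases c rule: int_cases2) (simp_all add: lookup_of_nat_mult)

lemma var_power: "var i ^ n = Poly_Mapping.single (Poly_Mapping.single i n) 1"
  by (induction n) (simp_all add: var_def mult_single flip: single_add)

lemma prod_var: "(\<Prod>x\<in>A. var (f x)) = Poly_Mapping.single (\<Sum>x\<in>A. Poly_Mapping.single (f x) 1) 1"
  by (induction A rule: infinite_finite_induct) (auto simp: var_def mult_single)

section \<open>Coefficients of products of powers of tail sums\<close>

definition tail_sum :: "nat \<Rightarrow> nat \<Rightarrow> int_mpoly" where
  "tail_sum z i = (\<Sum>l\<in>{i..z}. var l)"

text \<open>The extra power of the longest tail sum makes the family closed under extracting the
  variable \<open>x\<^sub>l\<close>.\<close>

definition tail_prod :: "nat \<Rightarrow> nat \<Rightarrow> nat \<Rightarrow> nat \<Rightarrow> int_mpoly" where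
  "tail_prod z l h n = tail_sum z l ^ h * (\<Prod>i\<in>{l..z}. tail_sum z i ^ n)"

definition const_monom :: "nat \<Rightarrow> nat \<Rightarrow> nat \<Rightarrow> monom" where
  "const_monom z l e = (\<Sum>i\<in>{l..z}. Poly_Mapping.single i e)"

lemma lookup_const_monom: "Poly_Mapping.lookup (const_monom z l e) i = (if i \<in> {l..z} then e else 0)"
  by (simp add: const_monom_def lookup_sum lookup_single when_def)

lemma const_monom_rec: "l \<le> z \<Longrightarrow> const_monom z l e = Poly_Mapping.single l e + const_monom z (Suc l) e"
  by (simp add: const_monom_def sum.atLeast_Suc_atMost)

lemma tail_sum_rec: "l \<le> z \<Longrightarrow> tail_sum z l = tail_sum z (Suc l) + var l"
  by (simp add: tail_sum_def sum.atLeast_Suc_atMost add.commute)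

text \<open>
  Since \<open>x\<^sub>l\<close> occurs only in the factors \<open>S\<^sub>l\<close>, its exponent in the target monomial leaves one term
  of the binomial expansion below; \<open>h\<close> is the surplus of factors carried over to \<open>S\<^bsub>l+1\<^esub>\<close>.
\<close>

lemma tail_prod_rec:
  assumes "l \<le> z"
  shows "tail_prod z l h n =
    (\<Sum>j\<le>n+h. of_nat ((n + h) choose j) * (var l ^ (n + h - j) * tail_prod z (Suc l) j n))"
proof -
  have "tail_prod z l h n = tail_sum z l ^ (n + h) * (\<Prod>i\<in>{Suc l..z}. tail_sum z i ^ n)"
    using assms by (simp add: tail_prod_def prod.atLeast_Suc_atMost power_add algebra_simps)
  also have "tail_sum z l ^ (n + h) =
      (\<Sum>j\<le>n+h. of_nat ((n + h) choose j) * tail_sum z (Suc l) ^ j * var l ^ (n + h - j))"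
    by (simp only: tail_sum_rec[OF assms] binomial_ring)
  finally show ?thesis
    by (simp add: tail_prod_def sum_distrib_left mult_ac)
qed

text \<open>The indicator weight of \<open>l\<close> encodes the absence of \<open>x\<^sub>l\<close>
  as homogeneity of degree 0.\<close>

lemma whomog_tail_prod:
  assumes "l < l'"
  shows "whomog (\<lambda>i. if i = l then 1 else 0) 0 (tail_prod z l' h n)"
proof -
  let ?w = "\<lambda>i. if i = l then 1 else 0 :: nat"
  have S: "whomog ?w 0 (tail_sum z i)" if "l' \<le> i" for i
    unfolding tail_sum_def using that assms by (intro whomog_sum whomog_var) auto
  have "whomog ?w 0 (\<Prod>i\<in>{l'..z}. tail_sum z i ^ n)"
    using whomog_prod[of "{l'..z}" ?w "\<lambda>_. 0" "\<lambda>i. tail_sum z i ^ n"] whomog_power[OF S] by simp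
  moreover have "whomog ?w 0 (tail_sum z l' ^ h)"
    using whomog_power[OF S[OF order_refl]] by simp
  ultimately show ?thesis
    unfolding tail_prod_def using whomog_mult by fastforce
qed

lemma lookup_single_mult_free:
  assumes "whomog (\<lambda>i. if i = l then 1 else 0) 0 P" "Poly_Mapping.lookup v l = 0"
  shows "Poly_Mapping.lookup (Poly_Mapping.single (Poly_Mapping.single l a) 1 * P)
      (Poly_Mapping.single l e + v) = (if a = e then Poly_Mapping.lookup P v else 0)"
proof (cases "a = e")
  case False
  let ?w = "\<lambda>i. if i = l then 1 else 0 :: nat"
  have "whomog ?w a (Poly_Mapping.single (Poly_Mapping.single l a) 1 * P)"
    using whomog_mult[OF whomog_single[of ?w "Poly_Mapping.single l a" a 1] assms(1)] by simp
  moreover have "wt ?w v = 0"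
    unfolding wt_def using assms(2) by (intro sum.neutral) auto
  hence "wt ?w (Poly_Mapping.single l e + v) = e"
    by (simp add: wt_add)
  ultimately show ?thesis
    using False by (auto simp: whomog_def in_keys_iff)
qed (simp add: lookup_single_mult)

text \<open>The exponent of \<open>x\<^sub>l\<close> is \<open>b\<close> from \<open>\<beta>\<close>
  plus \<open>n + h - j\<close> from the binomial term with index \<open>j\<close>. The target
  exponent \<open>n + e\<close> forces \<open>j = h + b - e\<close>, which is impossible if
  \<open>h + b < e\<close>.\<close>

lemma lookup_tail_prod_rec:
  fixes \<beta> :: monom
  assumes "l \<le> z"
  defines "b \<equiv> Poly_Mapping.lookup \<beta> l"
  shows "Poly_Mapping.lookup (Poly_Mapping.single \<beta> 1 * tail_prod z l h n) (const_monom z l (n + e)) =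
    (if h + b < e then 0
     else of_nat ((n + h) choose (h + b - e)) *
       Poly_Mapping.lookup (Poly_Mapping.single (\<beta> - Poly_Mapping.single l b) 1 *
         tail_prod z (Suc l) (h + b - e) n) (const_monom z (Suc l) (n + e)))"
proof -
  define \<beta>' where "\<beta>' = \<beta> - Poly_Mapping.single l b"
  define v where "v = const_monom z (Suc l) (n + e)"
  define R where "R = (\<lambda>j. Poly_Mapping.single \<beta>' 1 * tail_prod z (Suc l) j n)"
  have \<beta>: "\<beta> = Poly_Mapping.single l b + \<beta>'"
    by (rule poly_mapping_eqI) (simp add: \<beta>'_def b_def lookup_add lookup_minus lookup_single when_def)
  have free: "whomog (\<lambda>i. if i = l then 1 else 0) 0 (R j)" for j
  proof -
    have "wt (\<lambda>i. if i = l then 1 else 0) \<beta>' = 0"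
      unfolding wt_def by (rule sum.neutral) (simp add: \<beta>'_def b_def lookup_minus)
    thus ?thesis
      using whomog_mult[OF whomog_single whomog_tail_prod[of l "Suc l"]] by (fastforce simp: R_def)
  qed
  have v: "Poly_Mapping.lookup v l = 0"
    by (simp add: v_def lookup_const_monom)
  have "Poly_Mapping.single \<beta> 1 * tail_prod z l h n =
    (\<Sum>j\<le>n+h. of_nat ((n + h) choose j) *
      (Poly_Mapping.single (Poly_Mapping.single l (b + (n + h - j))) 1 * R j))"
    unfolding tail_prod_rec[OF assms(1)] sum_distrib_left R_def
  proof (rule sum.cong, goal_cases)
    case (2 j)
    have "Poly_Mapping.single \<beta> 1 * var l ^ (n + h - j) =
        Poly_Mapping.single (Poly_Mapping.single l (b + (n + h - j))) 1 * Poly_Mapping.single \<beta>' 1"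
      by (simp add: var_power mult_single \<beta> single_add algebra_simps)
    thus ?case by (simp add: algebra_simps)
  qed simp
  hence "Poly_Mapping.lookup (Poly_Mapping.single \<beta> 1 * tail_prod z l h n) (const_monom z l (n + e)) =
     (\<Sum>j\<le>n+h. if b + (n + h - j) = n + e then of_nat ((n + h) choose j) * Poly_Mapping.lookup (R j) v else 0)"
    using assms(1) unfolding const_monom_rec[OF assms(1)] v_def[symmetric]
    by (simp add: lookup_sum lookup_of_nat_mult lookup_single_mult_free[OF free v] if_distrib
        cong: if_cong)
  also have "\<dots> = (\<Sum>j\<le>n+h. if j = h + b - e \<and> e \<le> h + b then
      of_nat ((n + h) choose j) * Poly_Mapping.lookup (R j) v else 0)"
    by (rule sum.cong) auto
  \<comment> \<open>If \<open>h + b - e\<close> exceeds \<open>n + h\<close>, the index is out of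
    range on the left and the binomial coefficient on the right is 0.\<close>
  also have "\<dots> = (if h + b < e then 0 else of_nat ((n + h) choose (h + b - e)) * Poly_Mapping.lookup (R (h + b - e)) v)"
    by (cases "e \<le> h + b") (auto simp: sum.delta')
  finally show ?thesis
    by (simp add: R_def v_def \<beta>'_def)
qed

text \<open>The subtraction \<open>real h - real i\<close> does not truncate, so for
  \<open>j > n + h\<close> one factor vanishes at \<open>n\<close>, in agreement with the binomial
  coefficient.\<close>

definition binomial_poly :: "nat \<Rightarrow> nat \<Rightarrow> real poly" where
  "binomial_poly h j = smult (1 / fact j) (\<Prod>i<j. [:real h - real i, 1:])"

lemma poly_binomial_poly: "poly (binomial_poly h j) (real n) = real ((n + h) choose j)"
  by (simp add: binomial_poly_def poly_prod binomial_gbinomial gbinomial_prod_rev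
      atLeast0LessThan algebra_simps)

lemma degree_binomial_poly: "degree (binomial_poly h j) = j"
  by (simp add: binomial_poly_def degree_prod_eq_sum_degree)

lemma binomial_poly_nonzero: "binomial_poly h j \<noteq> 0"
  by (simp add: binomial_poly_def)

text \<open>
  Iterating the recursion gives a product of binomial coefficients \<open>(n + h\<^bsub>i-1\<^esub>) choose h\<^sub>i\<close> with
  \<open>h\<^sub>i = h + \<Sum>j\<le>i. (\<beta>\<^sub>j - e)\<close>, so the degree in \<open>n\<close> is the sum of the \<open>h\<^sub>i\<close>.
\<close>

lemma lookup_tail_prod_polynomial:
  fixes \<beta> :: monom and h e l z :: nat
  assumes "l \<le> Suc z"
  shows "\<exists>q :: real poly.
    (\<forall>n. of_int (Poly_Mapping.lookup (Poly_Mapping.single \<beta> 1 * tail_prod z l h n)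
            (const_monom z l (n + e))) = poly q (real n)) \<and>
    (q \<noteq> 0 \<longrightarrow> int (degree q) = int (Suc z - l) * int h +
       (\<Sum>j\<in>{l..z}. int (Suc z - j) * (int (Poly_Mapping.lookup \<beta> j) - int e))) \<and>
    (Poly_Mapping.keys \<beta> \<subseteq> {l..z} \<and>
       (\<forall>i\<in>{l..z}. int h + (\<Sum>j\<in>{l..i}. int (Poly_Mapping.lookup \<beta> j) - int e) \<ge> 0) \<and>
       int h + (\<Sum>j\<in>{l..z}. int (Poly_Mapping.lookup \<beta> j) - int e) = 0 \<longrightarrow> q \<noteq> 0)"
  using assms
proof (induction "Suc z - l" arbitrary: l h \<beta>)
  case 0
  hence l: "l = Suc z" by simp
  \<comment> \<open>No variable is left: the tail sum is empty, hence 0, and its power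
    \<open>h\<close> is nonzero only for \<open>h = 0\<close>.\<close>
  have *: "Poly_Mapping.single \<beta> 1 * tail_prod z (Suc z) h n =
      (if h = 0 then Poly_Mapping.single \<beta> 1 else 0)" for n
    by (simp add: tail_prod_def tail_sum_def)
  show ?case
    by (rule exI[of _ "if h = 0 \<and> \<beta> = 0 then 1 else 0"])
      (auto simp: l const_monom_def * lookup_single when_def)
next
  case (Suc s)
  hence l: "l \<le> z" by simp
  define b where "b = Poly_Mapping.lookup \<beta> l"
  define \<beta>' where "\<beta>' = \<beta> - Poly_Mapping.single l b"
  define j where "j = h + b - e"
  have \<beta>': "Poly_Mapping.lookup \<beta>' i = (if i = l then 0 else Poly_Mapping.lookup \<beta> i)" for i
    by (simp add: \<beta>'_def b_def lookup_minus lookup_single when_def)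
  have sum\<beta>': "(\<Sum>i\<in>{Suc l..y}. f i (Poly_Mapping.lookup \<beta>' i)) =
      (\<Sum>i\<in>{Suc l..y}. f i (Poly_Mapping.lookup \<beta> i))" for y and f :: "nat \<Rightarrow> nat \<Rightarrow> int"
    by (rule sum.cong) (auto simp: \<beta>')
  note rec = lookup_tail_prod_rec[OF l, of \<beta> h _ e, folded b_def, folded \<beta>'_def j_def]
  show ?case
  proof (cases "h + b < e")
    case True
    \<comment> \<open>The partial sum at \<open>i = l\<close> is negative, so the nonvanishing
      criterion does not apply and the zero polynomial serves.\<close>
    hence "\<not> int h + (\<Sum>j\<in>{l..l}. int (Poly_Mapping.lookup \<beta> j) - int e) \<ge> 0"
      by (simp add: b_def)
    thus ?thesis
      using l True by (intro exI[of _ 0]) (fastforce simp: rec)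
  next
    case False
    hence j: "int j = int h + int b - int e" by (simp add: j_def)
    have s: "s = Suc z - Suc l" "Suc l \<le> Suc z" using Suc l by auto
    obtain q where q: "\<And>n. of_int (Poly_Mapping.lookup (Poly_Mapping.single \<beta>' 1 * tail_prod z (Suc l) j n)
            (const_monom z (Suc l) (n + e))) = poly q (real n)"
      "q \<noteq> 0 \<Longrightarrow> int (degree q) = int (Suc z - Suc l) * int j +
       (\<Sum>j\<in>{Suc l..z}. int (Suc z - j) * (int (Poly_Mapping.lookup \<beta>' j) - int e))"
     "Poly_Mapping.keys \<beta>' \<subseteq> {Suc l..z} \<Longrightarrow>
       (\<forall>i\<in>{Suc l..z}. int j + (\<Sum>j\<in>{Suc l..i}. int (Poly_Mapping.lookup \<beta>' j) - int e) \<ge> 0) \<Longrightarrow>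
       int j + (\<Sum>j\<in>{Suc l..z}. int (Poly_Mapping.lookup \<beta>' j) - int e) = 0 \<Longrightarrow> q \<noteq> 0"
      using Suc.hyps(1)[OF s, of \<beta>' j] by blast
    \<comment> \<open>Moving index \<open>l\<close> into the surplus leaves the partial sums
      unchanged, so the criterion passes to the smaller instance.\<close>
    have step: "int h + (\<Sum>j\<in>{l..i}. int (Poly_Mapping.lookup \<beta> j) - int e) =
       int j + (\<Sum>j\<in>{Suc l..i}. int (Poly_Mapping.lookup \<beta>' j) - int e)" if "l \<le> i" for i
      using that sum\<beta>'[of "\<lambda>_ b. int b - int e" i]
      by (simp add: sum.atLeast_Suc_atMost j b_def)
    show ?thesis
    proof (intro exI[of _ "binomial_poly h j * q"] conjI allI impI)
      fix n
      show "of_int (Poly_Mapping.lookup (Poly_Mapping.single \<beta> 1 * tail_prod z l h n)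
          (const_monom z l (n + e))) = poly (binomial_poly h j * q) (real n)"
        using False by (simp add: rec poly_binomial_poly q(1))
    next
      assume "binomial_poly h j * q \<noteq> 0"
      hence "int (degree (binomial_poly h j * q)) = int j + int (degree q)" "q \<noteq> 0"
        by (auto simp: degree_mult_eq degree_binomial_poly)
      \<comment> \<open>Since \<open>j = h + b - e\<close>, the terms with factor
        \<open>Suc z - l\<close> add up to \<open>(Suc z - l) * j\<close>. One \<open>j\<close> is
        the degree of the binomial, and the other \<open>Suc z - Suc l\<close> belong to
        \<open>q\<close>.\<close>
      thus "int (degree (binomial_poly h j * q)) = int (Suc z - l) * int h +
         (\<Sum>j\<in>{l..z}. int (Suc z - j) * (int (Poly_Mapping.lookup \<beta> j) - int e))"
        using l sum\<beta>'[of "\<lambda>j b. int (Suc z - j) * (int b - int e)" z]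
        by (simp add: q(2) sum.atLeast_Suc_atMost b_def[symmetric] j Suc_diff_le algebra_simps)
    next
      assume *: "Poly_Mapping.keys \<beta> \<subseteq> {l..z} \<and>
       (\<forall>i\<in>{l..z}. int h + (\<Sum>j\<in>{l..i}. int (Poly_Mapping.lookup \<beta> j) - int e) \<ge> 0) \<and>
       int h + (\<Sum>j\<in>{l..z}. int (Poly_Mapping.lookup \<beta> j) - int e) = 0"
      have "q \<noteq> 0"
      proof (rule q(3))
        show "Poly_Mapping.keys \<beta>' \<subseteq> {Suc l..z}"
        proof
          fix i assume "i \<in> Poly_Mapping.keys \<beta>'"
          hence "i \<noteq> l" "i \<in> Poly_Mapping.keys \<beta>" by (auto simp: \<beta>' in_keys_iff split: if_splits)
          thus "i \<in> {Suc l..z}" using * by fastforce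
        qed
      qed (use * l step in auto)
      thus "binomial_poly h j * q \<noteq> 0" by (simp add: binomial_poly_nonzero)
    qed
  qed
qed

section \<open>The factor independent of \<open>k\<close> and its extremal monomial\<close>

abbreviation pairs :: "nat \<Rightarrow> nat \<Rightarrow> (nat \<times> nat) set" where
  "pairs a k \<equiv> {(i, j). a \<le> i \<and> i < j \<and> j \<le> k}"

lemma finite_pairs [simp]: "finite (pairs a k)"
  by (rule finite_subset[of _ "{..k} \<times> {..k}"]) auto

lemma card_pairs_fst:
  "card {x \<in> A. fst x = i} = card {j. (i, j) \<in> A}"
proof -
  have "{x \<in> A. fst x = i} = (\<lambda>j. (i, j)) ` {j. (i, j) \<in> A}" by force
  thus ?thesis by (simp add: card_image inj_on_def)
qed

lemma lookup_sum_fst: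
  assumes "finite A"
  shows "Poly_Mapping.lookup (\<Sum>x\<in>A. Poly_Mapping.single (fst x) (1::nat)) i = card {j. (i, j) \<in> A}"
proof -
  have "{x \<in> A. fst x = i} = A \<inter> {x. fst x = i}" by auto
  thus ?thesis
    using assms by (simp add: lookup_sum lookup_single when_def sum.If_cases flip: card_pairs_fst)
qed

lemma prod_uminus_var:
  "(\<Prod>x\<in>A. - var (f x)) = (-1) ^ card A * Poly_Mapping.single (\<Sum>x\<in>A. Poly_Mapping.single (f x) 1) 1"
  by (subst prod_var[symmetric]) (rule prod_uminus)

text \<open>This is the factor \<open>B\<close>: it arises from \<open>f_poly z\<close> by removing
  the differences with \<open>x\<^sub>1\<close>.\<close>

definition core :: "nat \<Rightarrow> int_mpoly" where
  "core z = (\<Prod>(i, j)\<in>pairs 2 z. var j - var i) * (\<Prod>(i, j)\<in>pairs 2 z. \<Sum>l\<in>{i..j}. var l)"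

definition core_monom :: "nat \<Rightarrow> monom" where
  "core_monom z = (\<Sum>x\<in>pairs 2 z. Poly_Mapping.single (fst x) 1) + (\<Sum>x\<in>pairs 2 z. Poly_Mapping.single (fst x) 1)"

lemma lookup_core_monom: "Poly_Mapping.lookup (core_monom z) i = (if i \<in> {2..z} then 2 * (z - i) else 0)"
proof -
  have fiber: "{j. (i, j) \<in> pairs 2 z} = (if 2 \<le> i then {i<..z} else {})" by auto
  show ?thesis
    unfolding core_monom_def lookup_add lookup_sum_fst[OF finite_pairs] fiber
    by (simp flip: mult_2)
qed

text \<open>The weights decrease strictly up to \<open>z\<close>, so each factor is led by its
  variable of smallest index. The same weights multiply the exponents in the degree of a
  contribution to \<open>Q\<close>.\<close>

lemma leading_form_core:
  "\<exists>N. leading_form (\<lambda>i. Suc z - i) N (core z)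
     ((-1) ^ card (pairs 2 z) * Poly_Mapping.single (core_monom z) 1)"
proof -
  let ?w = "\<lambda>i. Suc z - i"
  have "leading_form ?w (\<Sum>x\<in>pairs 2 z. ?w (fst x))
      (\<Prod>(i, j)\<in>pairs 2 z. var j - var i) (\<Prod>x\<in>pairs 2 z. - var (fst x))"
    by (intro leading_form_prod) (auto intro!: leading_form_var_diff[where w = ?w])
  moreover have "leading_form ?w (\<Sum>x\<in>pairs 2 z. ?w (fst x))
      (\<Prod>(i, j)\<in>pairs 2 z. \<Sum>l\<in>{i..j}. var l) (\<Prod>x\<in>pairs 2 z. var (fst x))"
  proof (intro leading_form_prod, clarsimp)
    fix i j assume "2 \<le> i" "i < j" "j \<le> z"
    thus "leading_form ?w (Suc z - i) (\<Sum>l = i..j. var l) (var i)"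
      using leading_form_sum_var[of "{i..j}" "{i}" ?w] by fastforce
  qed
  ultimately have "leading_form ?w ((\<Sum>x\<in>pairs 2 z. ?w (fst x)) + (\<Sum>x\<in>pairs 2 z. ?w (fst x)))
     (core z) ((-1) ^ card (pairs 2 z) * Poly_Mapping.single (core_monom z) 1)"
    unfolding core_def core_monom_def prod_uminus_var prod_var
    by (metis (no_types, lifting) leading_form_mult mult.assoc mult_single mult_1)
  thus ?thesis by blast
qed

lemma sum_weighted_excess:
  assumes "z \<ge> 1"
  shows "6 * (\<Sum>j\<in>{2..z}. int (Suc z - j) * (2 * (int z - int j) - (int z - 2))) =
    (int z - 2) * (int z - 1) * int z"
proof -
  \<comment> \<open>Here \<open>m = z - j\<close>. For \<open>M = z - 1\<close> and
    \<open>c = z - 2\<close> the two terms on the right are 4 and 3 times the same product.\<close>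
  have *: "6 * (\<Sum>m<M. (int m + 1) * (2 * int m - c)) =
      4 * (int M - 1) * int M * (int M + 1) - 3 * c * int M * (int M + 1)" for M c
    by (induction M) (simp_all add: algebra_simps)
  have "(\<Sum>j\<in>{2..z}. int (Suc z - j) * (2 * (int z - int j) - (int z - 2))) =
      (\<Sum>m<z - 1. (int m + 1) * (2 * int m - (int z - 2)))"
    by (rule sum.reindex_bij_witness[of _ "\<lambda>m. z - m" "\<lambda>j. z - j"]) (auto simp: of_nat_diff)
  hence "6 * (\<Sum>j\<in>{2..z}. int (Suc z - j) * (2 * (int z - int j) - (int z - 2))) =
      4 * (int (z - 1) - 1) * int (z - 1) * (int (z - 1) + 1) - 3 * (int z - 2) * int (z - 1) * (int (z - 1) + 1)"
    by (simp only: *)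
  thus ?thesis
    using assms by (simp add: of_nat_diff algebra_simps)
qed

text \<open>Up to a constant, the degree of a contribution is the weight used in
  \<open>leading_form_core\<close>. Uniqueness of the top monomial there excludes cancellation of
  the leading coefficient.\<close>

lemma core_coeff_polynomial:
  assumes "z \<ge> 3"
  shows "\<exists>q :: real poly. q \<noteq> 0 \<and> 6 * degree q \<le> (z - 2) * (z - 1) * z \<and>
    (\<forall>n. of_int (Poly_Mapping.lookup (core z * (\<Prod>i\<in>{2..z}. tail_sum z i ^ n))
       (const_monom z 2 (n + (z - 2)))) = poly q (real n))"
proof -
  \<comment> \<open>The value for which degrees agree: \<open>core z\<close> has degree
    \<open>(z - 1) * (z - 2)\<close>, to be spread over \<open>z - 1\<close> variables.\<close>
  define e where "e = z - 2"
  let ?w = "\<lambda>i. Suc z - i"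
  define D where "D = (\<lambda>\<beta>::monom. \<Sum>j\<in>{2..z}. int (Suc z - j) * (int (Poly_Mapping.lookup \<beta> j) - int e))"
  have ex: "\<forall>\<beta>. \<exists>q :: real poly.
     (\<forall>n. of_int (Poly_Mapping.lookup (Poly_Mapping.single \<beta> 1 * tail_prod z 2 0 n)
            (const_monom z 2 (n + e))) = poly q (real n)) \<and>
    (q \<noteq> 0 \<longrightarrow> int (degree q) = D \<beta>) \<and>
    (Poly_Mapping.keys \<beta> \<subseteq> {2..z} \<and>
       (\<forall>i\<in>{2..z}. (\<Sum>j\<in>{2..i}. int (Poly_Mapping.lookup \<beta> j) - int e) \<ge> 0) \<and>
       (\<Sum>j\<in>{2..z}. int (Poly_Mapping.lookup \<beta> j) - int e) = 0 \<longrightarrow> q \<noteq> 0)"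
    (is "\<forall>\<beta>. \<exists>q. ?P \<beta> q")
    using lookup_tail_prod_polynomial[of 2 z _ 0 e] assms unfolding D_def by simp
  from choice[OF ex] obtain q where qP: "\<forall>\<beta>. ?P \<beta> (q \<beta>)" ..
  have q: "of_int (Poly_Mapping.lookup (Poly_Mapping.single \<beta> 1 * tail_prod z 2 0 n)
            (const_monom z 2 (n + e))) = poly (q \<beta>) (real n)" for \<beta> n
    using qP by blast
  have deg: "int (degree (q \<beta>)) = D \<beta>" if "q \<beta> \<noteq> 0" for \<beta>
    using qP that by blast
  have nz: "q \<beta> \<noteq> 0" if "Poly_Mapping.keys \<beta> \<subseteq> {2..z}"
     "\<And>i. i \<in> {2..z} \<Longrightarrow> (\<Sum>j\<in>{2..i}. int (Poly_Mapping.lookup \<beta> j) - int e) \<ge> 0"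
     "(\<Sum>j\<in>{2..z}. int (Poly_Mapping.lookup \<beta> j) - int e) = 0" for \<beta>
    using qP that by blast
  define \<mu> where "\<mu> = core_monom z"
  \<comment> \<open>The closed form is nonnegative on the range and 0 at \<open>i = z\<close>, as
    the nonvanishing criterion demands. The induction starts at \<open>i = 1\<close>, where the sum
    is empty.\<close>
  have part: "(\<Sum>j\<in>{2..i}. int (Poly_Mapping.lookup \<mu> j) - int e) = (int i - 1) * (int z - int i)"
    if "i \<in> {2..z}" for i
  proof -
    have "Suc 0 \<le> i" using that by simp
    hence "i \<le> z \<Longrightarrow> (\<Sum>j\<in>{2..i}. int (Poly_Mapping.lookup \<mu> j) - int e) = (int i - 1) * (int z - int i)"
    proof (induction i rule: dec_induct)
      case (step i)
      thus ?case using assms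
        by (simp add: \<mu>_def lookup_core_monom e_def of_nat_diff algebra_simps)
    qed simp
    thus ?thesis using that by simp
  qed
  have "q \<mu> \<noteq> 0"
  proof (rule nz)
    show "Poly_Mapping.keys \<mu> \<subseteq> {2..z}"
      by (auto simp: \<mu>_def in_keys_iff lookup_core_monom split: if_splits)
  qed (use assms part in auto)
  hence deg\<mu>: "int (degree (q \<mu>)) = D \<mu>" by (rule deg)
  have "6 * D \<mu> = 6 * (\<Sum>j\<in>{2..z}. int (Suc z - j) * (2 * (int z - int j) - (int z - 2)))"
    unfolding D_def using assms
    by (intro arg_cong2[where f = "(*)"] sum.cong refl) (simp add: \<mu>_def lookup_core_monom e_def of_nat_diff)
  hence D\<mu>: "6 * D \<mu> = (int z - 2) * (int z - 1) * int z"
    by (rule trans) (rule sum_weighted_excess, use assms in simp)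
  obtain N where lf: "leading_form ?w N (core z) ((-1) ^ card (pairs 2 z) * Poly_Mapping.single \<mu> 1)"
    using leading_form_core unfolding \<mu>_def by blast
  define c :: int where "c = (-1) ^ card (pairs 2 z)"
  have sgn: "((-1) ^ card (pairs 2 z) :: int_mpoly) = 1 \<and> c = 1 \<or> ((-1) ^ card (pairs 2 z) :: int_mpoly) = -1 \<and> c = -1"
    by (cases "even (card (pairs 2 z))") (auto simp: c_def)
  have coeff\<mu>: "Poly_Mapping.lookup (core z) \<mu> = c"
    using leading_form_lookup[OF lf, of \<mu>] sgn by auto
  have less: "q \<beta> = 0 \<or> degree (q \<beta>) < degree (q \<mu>)" if \<beta>: "\<beta> \<in> Poly_Mapping.keys (core z) - {\<mu>}" for \<beta>
  proof (rule disjCI)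
    assume "\<not> degree (q \<beta>) < degree (q \<mu>)"
    have "wt ?w \<beta> < wt ?w \<mu>"
      using leading_form_single_less[OF lf] \<beta> sgn by blast
    \<comment> \<open>An inequality suffices: \<open>D\<close> sees only the indices in
      \<open>{2..z}\<close>, and the other terms of the weight are nonnegative.\<close>
    moreover have "(\<Sum>j\<in>{2..z}. ?w j * Poly_Mapping.lookup \<beta> j) \<le> wt ?w \<beta>"
    proof -
      have "(\<Sum>j\<in>{2..z}. ?w j * Poly_Mapping.lookup \<beta> j) \<le> (\<Sum>j\<in>{2..z} \<union> Poly_Mapping.keys \<beta>. ?w j * Poly_Mapping.lookup \<beta> j)"
        by (rule sum_mono2) auto
      thus ?thesis by (simp flip: wt_superset)
    qed
    moreover have "wt ?w \<mu> = (\<Sum>j\<in>{2..z}. ?w j * Poly_Mapping.lookup \<mu> j)"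
      by (rule wt_superset) (auto simp: \<mu>_def in_keys_iff lookup_core_monom split: if_splits)
    ultimately have "int (\<Sum>j\<in>{2..z}. ?w j * Poly_Mapping.lookup \<beta> j) < int (\<Sum>j\<in>{2..z}. ?w j * Poly_Mapping.lookup \<mu> j)"
      by linarith
    hence "D \<beta> < D \<mu>"
      by (simp add: D_def right_diff_distrib sum_subtractf)
    thus "q \<beta> = 0"
      using deg[of \<beta>] deg\<mu> \<open>\<not> degree (q \<beta>) < degree (q \<mu>)\<close> by linarith
  qed
  define Q where "Q = (\<Sum>\<beta>\<in>Poly_Mapping.keys (core z). smult (of_int (Poly_Mapping.lookup (core z) \<beta>)) (q \<beta>))"
  have \<mu>_in: "\<mu> \<in> Poly_Mapping.keys (core z)"
    using coeff\<mu> sgn by (auto simp: in_keys_iff)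
  \<comment> \<open>By \<open>less\<close>, no other contribution reaches this degree.\<close>
  have "coeff Q (degree (q \<mu>)) = of_int c * lead_coeff (q \<mu>)"
  proof -
    have "coeff Q (degree (q \<mu>)) = (\<Sum>\<beta>\<in>Poly_Mapping.keys (core z).
        if \<beta> = \<mu> then of_int c * lead_coeff (q \<mu>) else 0)"
      unfolding Q_def coeff_sum using less
      by (intro sum.cong) (auto simp: coeff\<mu> intro: coeff_eq_0, metis coeff_0 coeff_eq_0)
    thus ?thesis using \<mu>_in by simp
  qed
  hence "Q \<noteq> 0"
    using \<open>q \<mu> \<noteq> 0\<close> sgn by auto
  moreover have "degree Q \<le> degree (q \<mu>)"
    unfolding Q_def using less
    by (intro degree_sum_le) (force intro: order.trans[OF degree_smult_le] less_imp_le)+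
  hence "6 * int (degree Q) \<le> int ((z - 2) * (z - 1) * z)"
    using deg\<mu> D\<mu> assms by (simp add: of_nat_diff)
  hence "6 * degree Q \<le> (z - 2) * (z - 1) * z"
    by linarith
  moreover have "of_int (Poly_Mapping.lookup (core z * (\<Prod>i\<in>{2..z}. tail_sum z i ^ n))
       (const_monom z 2 (n + (z - 2)))) = poly Q (real n)" for n
  proof -
    have "core z * (\<Prod>i\<in>{2..z}. tail_sum z i ^ n) = (\<Sum>\<beta>\<in>Poly_Mapping.keys (core z).
       Poly_Mapping.single \<beta> (Poly_Mapping.lookup (core z) \<beta>) * tail_prod z 2 0 n)"
      by (subst mpoly_expand[of "core z"]) (simp add: tail_prod_def sum_distrib_right)
    also have "\<dots> = (\<Sum>\<beta>\<in>Poly_Mapping.keys (core z).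
       of_int (Poly_Mapping.lookup (core z) \<beta>) * (Poly_Mapping.single \<beta> 1 * tail_prod z 2 0 n))"
      by (rule sum.cong) (simp_all add: mult_single flip: single_of_int mult.assoc)
    finally show ?thesis
      by (simp add: lookup_sum lookup_of_int_mult Q_def poly_sum q[unfolded e_def])
  qed
  ultimately show ?thesis by blast
qed

section \<open>A bounded monomial\<close>

text \<open>Two consecutive triangular numbers add up to a square. This counts the linear factors of
  \<open>f_poly (Suc n)\<close>.\<close>

lemma card_pairs_1_2: "card (pairs 1 (Suc n)) + card (pairs 2 (Suc n)) = n\<^sup>2"
proof -
  have rec: "card (pairs a (Suc m)) = card (pairs a m) + (Suc m - a)" if "a \<le> Suc m" for a m
  proof -
    have "pairs a (Suc m) = pairs a m \<union> {a..m} \<times> {Suc m}" using that by auto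
    moreover have "pairs a m \<inter> {a..m} \<times> {Suc m} = {}" by auto
    ultimately show ?thesis using that by (simp add: card_Un_disjoint card_cartesian_product)
  qed
  show ?thesis
  proof (induction n)
    case 0
    have "pairs 1 (Suc 0) = {}" "pairs 2 (Suc 0) = {}" by auto
    thus ?case by simp
  next
    case (Suc n)
    thus ?case using rec[of 1 "Suc n"] rec[of 2 "Suc n"] by (simp add: power2_eq_square)
  qed
qed

lemma whomog_f_poly:
  assumes "k \<ge> 1"
  shows "whomog (\<lambda>_. 1) ((k - 1)\<^sup>2) (f_poly k)"
proof -
  have "whomog (\<lambda>_. 1) ((\<Sum>x\<in>pairs 1 k. 1) + (\<Sum>x\<in>pairs 2 k. 1)) (f_poly k)"
    unfolding f_poly_def
    by (intro whomog_mult whomog_prod) (auto intro!: whomog_diff whomog_sum whomog_var)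
  thus ?thesis using card_pairs_1_2[of "k - 1"] assms by simp
qed

lemma lookup_var_sum: "Poly_Mapping.lookup (\<Sum>l\<in>A. var l) (Poly_Mapping.single i 1) =
  (if finite A \<and> i \<in> A then 1 else 0)"
proof -
  have "Poly_Mapping.single i (1::nat) = Poly_Mapping.single l 1 \<longleftrightarrow> i = l" for l
    by (metis lookup_single_eq lookup_single_not_eq zero_neq_one)
  thus ?thesis
    by (cases "finite A") (simp_all add: lookup_sum var_def lookup_single when_def)
qed

text \<open>Every factor is a nonzero linear form and the polynomial ring is an integral
  domain.\<close>

lemma f_poly_nonzero: "f_poly k \<noteq> 0"
proof -
  have "var j - var i \<noteq> 0" if "i < j" for i j
  proof
    assume "var j - var i = 0"
    hence "Poly_Mapping.lookup (\<Sum>l\<in>{j}. var l) (Poly_Mapping.single j 1) =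
        Poly_Mapping.lookup (\<Sum>l\<in>{i}. var l) (Poly_Mapping.single j 1)" by simp
    thus False using that unfolding lookup_var_sum by simp
  qed
  moreover have "(\<Sum>l\<in>{i..j}. var l) \<noteq> 0" if "i < j" for i j
  proof
    assume "(\<Sum>l\<in>{i..j}. var l) = 0"
    hence "Poly_Mapping.lookup (\<Sum>l\<in>{i..j}. var l) (Poly_Mapping.single j 1) = 0" by simp
    thus False using that unfolding lookup_var_sum by simp
  qed
  ultimately show ?thesis
    by (auto simp: f_poly_def)
qed

lemma homogeneous_f_poly: "k \<ge> 1 \<Longrightarrow> homogeneous_of_degree ((k - 1)\<^sup>2) (f_poly k)"
  using whomog_f_poly[of k] f_poly_nonzero[of k]
  by (simp add: homogeneous_of_degree_def whomog_def mdegree_eq_wt)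

section \<open>The leading form of \<open>f_poly k\<close> and the exponent bound\<close>

definition outer_monom :: "nat \<Rightarrow> nat \<Rightarrow> monom" where
  "outer_monom z k = (\<Sum>x\<in>pairs 1 k - pairs 2 z. Poly_Mapping.single (fst x) 1) +
     (\<Sum>x\<in>pairs (Suc z) k. Poly_Mapping.single (fst x) 1)"

lemma lookup_outer_monom:
  assumes "1 \<le> z" "z \<le> k"
  shows "Poly_Mapping.lookup (outer_monom z k) i =
    (if i = 0 then 0 else if i = 1 then k - 1 else if i \<le> z then k - z else 2 * (k - i))"
proof -
  have 1: "{j. (i, j) \<in> pairs 1 k - pairs 2 z} =
      (if i = 0 then {} else if i = 1 \<or> i > z then {i<..k} else {z<..k})"
    using assms by auto
  have 2: "{j. (i, j) \<in> pairs (Suc z) k} = (if i \<le> z then {} else {i<..k})"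
    by auto
  show ?thesis
    using assms unfolding outer_monom_def lookup_add lookup_sum_fst[OF finite_pairs]
      lookup_sum_fst[OF finite_Diff[OF finite_pairs]] 1 2 by auto
qed

lemma leading_form_f_poly:
  assumes "1 \<le> z" "z \<le> k"
  shows "\<exists>w N. leading_form w N (f_poly k) ((-1) ^ card (pairs 1 k - pairs 2 z) *
    (Poly_Mapping.single (outer_monom z k) 1 * (core z * (\<Prod>i\<in>{2..z}. tail_sum z i ^ (k - z)))))"
proof -
  \<comment> \<open>\<open>x\<^sub>1\<close> dominates, \<open>x\<^sub>2, ..., x\<^sub>z\<close> are tied, and the remaining weights decrease strictly below them.\<close>
  define w where "w i = (if i \<le> 1 then 2 * k else if i \<le> z then k else Suc k - i)" for i
  \<comment> \<open>\<open>V\<close> and \<open>L\<close> are the leading forms of the factors. A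
    difference stays whole only within the tied block \<open>{2..z}\<close>. A sum starting at
    \<open>i \<le> z\<close> keeps its part up to \<open>z\<close>, and one starting above
    \<open>z\<close> keeps only its first variable.\<close>
  define V where "V i j = (if 2 \<le> i \<and> j \<le> z then var j - var i else - var i)" for i j
  define L where "L i j = (\<Sum>l\<in>(if i \<le> z then {i..min j z} else {i}). var l)" for i j
  define M where "M A = Poly_Mapping.single (\<Sum>x\<in>A. Poly_Mapping.single (fst x) (1::nat)) (1::int)" for A :: "(nat \<times> nat) set"
  have "leading_form w (w i) (var j - var i) (V i j)" if "(i, j) \<in> pairs 1 k" for i j
  proof (cases "2 \<le> i \<and> j \<le> z")
    case True
    thus ?thesis using that
      by (auto simp: V_def w_def intro!: leading_form_self whomog_diff whomog_var)
  next
    case False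
    hence "w j < w i" using that assms by (auto simp: w_def)
    thus ?thesis using False leading_form_var_diff[of w j i] by (auto simp: V_def)
  qed
  hence "leading_form w (\<Sum>x\<in>pairs 1 k. w (fst x)) (\<Prod>(i, j)\<in>pairs 1 k. var j - var i)
      (\<Prod>(i, j)\<in>pairs 1 k. V i j)"
    by (intro leading_form_prod) auto
  moreover have "leading_form w (w i) (\<Sum>l\<in>{i..j}. var l) (L i j)" if "(i, j) \<in> pairs 2 k" for i j
    unfolding L_def using that assms
    by (intro leading_form_sum_var) (auto simp: w_def split: if_splits)
  hence "leading_form w (\<Sum>x\<in>pairs 2 k. w (fst x)) (\<Prod>(i, j)\<in>pairs 2 k. \<Sum>l\<in>{i..j}. var l)
      (\<Prod>(i, j)\<in>pairs 2 k. L i j)"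
    by (intro leading_form_prod) auto
  ultimately have lf: "leading_form w ((\<Sum>x\<in>pairs 1 k. w (fst x)) + (\<Sum>x\<in>pairs 2 k. w (fst x)))
      (f_poly k) ((\<Prod>(i, j)\<in>pairs 1 k. V i j) * (\<Prod>(i, j)\<in>pairs 2 k. L i j))"
    unfolding f_poly_def by (rule leading_form_mult)
  have "(\<Prod>(i, j)\<in>pairs 1 k. V i j) =
      (\<Prod>(i, j)\<in>pairs 1 k - pairs 2 z. V i j) * (\<Prod>(i, j)\<in>pairs 2 z. V i j)"
    using assms by (intro prod.subset_diff) auto
  also have "(\<Prod>(i, j)\<in>pairs 1 k - pairs 2 z. V i j) = (\<Prod>x\<in>pairs 1 k - pairs 2 z. - var (fst x))"
    by (rule prod.cong[OF refl]) (clarsimp simp: V_def)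
  also have "(\<Prod>(i, j)\<in>pairs 2 z. V i j) = (\<Prod>(i, j)\<in>pairs 2 z. var j - var i)"
    by (rule prod.cong) (auto simp: V_def)
  finally have V: "(\<Prod>(i, j)\<in>pairs 1 k. V i j) = (-1) ^ card (pairs 1 k - pairs 2 z) *
      M (pairs 1 k - pairs 2 z) * (\<Prod>(i, j)\<in>pairs 2 z. var j - var i)"
    by (simp only: prod_uminus_var M_def)
  \<comment> \<open>Intervals within the tied block, crossing its end, and beyond it. Each
    \<open>i\<close> in the block starts \<open>k - z\<close> crossing intervals, all reduced to
    \<open>tail_sum z i\<close>.\<close>
  have "pairs 2 k = pairs 2 z \<union> {2..z} \<times> {z<..k} \<union> pairs (Suc z) k"
    using assms by auto
  hence "(\<Prod>(i, j)\<in>pairs 2 k. L i j) = (\<Prod>(i, j)\<in>pairs 2 z \<union> {2..z} \<times> {z<..k} \<union> pairs (Suc z) k. L i j)"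
    by simp
  also have "\<dots> = (\<Prod>(i, j)\<in>pairs 2 z \<union> {2..z} \<times> {z<..k}. L i j) * (\<Prod>(i, j)\<in>pairs (Suc z) k. L i j)"
    by (rule prod.union_disjoint) auto
  also have "(\<Prod>(i, j)\<in>pairs 2 z \<union> {2..z} \<times> {z<..k}. L i j) =
      (\<Prod>(i, j)\<in>pairs 2 z. L i j) * (\<Prod>(i, j)\<in>{2..z} \<times> {z<..k}. L i j)"
    by (rule prod.union_disjoint) auto
  also have "(\<Prod>(i, j)\<in>pairs 2 z. L i j) = (\<Prod>(i, j)\<in>pairs 2 z. \<Sum>l\<in>{i..j}. var l)"
    by (rule prod.cong) (auto simp: L_def min_def)
  also have "(\<Prod>(i, j)\<in>pairs (Suc z) k. L i j) = (\<Prod>x\<in>pairs (Suc z) k. var (fst x))"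
    by (rule prod.cong) (auto simp: L_def)
  also have "\<dots> = M (pairs (Suc z) k)"
    by (simp only: prod_var M_def)
  also have "(\<Prod>(i, j)\<in>{2..z} \<times> {z<..k}. L i j) = (\<Prod>(i, j)\<in>{2..z} \<times> {z<..k}. tail_sum z i)"
    by (rule prod.cong) (auto simp: L_def tail_sum_def)
  also have "\<dots> = (\<Prod>i\<in>{2..z}. tail_sum z i ^ (k - z))"
    by (subst prod.cartesian_product[symmetric]) simp
  finally have L: "(\<Prod>(i, j)\<in>pairs 2 k. L i j) = (\<Prod>(i, j)\<in>pairs 2 z. \<Sum>l\<in>{i..j}. var l) *
    (\<Prod>i\<in>{2..z}. tail_sum z i ^ (k - z)) * M (pairs (Suc z) k)" .
  have "Poly_Mapping.single (outer_monom z k) 1 = M (pairs 1 k - pairs 2 z) * M (pairs (Suc z) k)"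
    by (simp add: outer_monom_def M_def mult_single)
  hence "(\<Prod>(i, j)\<in>pairs 1 k. V i j) * (\<Prod>(i, j)\<in>pairs 2 k. L i j) =
     (-1) ^ card (pairs 1 k - pairs 2 z) *
    (Poly_Mapping.single (outer_monom z k) 1 * (core z * (\<Prod>i\<in>{2..z}. tail_sum z i ^ (k - z))))"
    unfolding V L core_def by (simp only: mult_ac)
  thus ?thesis using lf by auto
qed

lemma has_monomial_bounded_f_poly:
  assumes "4 \<le> d" "d \<le> k"
    and nz: "Poly_Mapping.lookup (core (d - 1) * (\<Prod>i\<in>{2..d-1}. tail_sum (d - 1) i ^ (k - (d - 1))))
       (const_monom (d - 1) 2 (k - (d - 1) + (d - 1 - 2))) \<noteq> 0"
  shows "has_monomial_bounded (f_poly k) ((k - 1)\<^sup>2) (2 * k - d - 1)"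
proof -
  let ?z = "d - 1"
  define H where "H = core ?z * (\<Prod>i\<in>{2..?z}. tail_sum ?z i ^ (k - ?z))"
  define v where "v = const_monom ?z 2 (k - ?z + (?z - 2))"
  define m where "m = outer_monom ?z k + v"
  obtain w N where lf: "leading_form w N (f_poly k) ((-1) ^ card (pairs 1 k - pairs 2 ?z) *
     (Poly_Mapping.single (outer_monom ?z k) 1 * H))"
  proof -
    have "1 \<le> ?z" "?z \<le> k" using assms(1,2) by auto
    from leading_form_f_poly[OF this] show ?thesis using that unfolding H_def by blast
  qed
  have "Poly_Mapping.lookup ((-1) ^ card (pairs 1 k - pairs 2 ?z) *
     (Poly_Mapping.single (outer_monom ?z k) 1 * H)) m \<noteq> 0"
    using nz unfolding m_def H_def[symmetric] v_def[symmetric]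
    by (cases "even (card (pairs 1 k - pairs 2 ?z))") (simp_all add: lookup_single_mult)
  hence m: "Poly_Mapping.lookup (f_poly k) m \<noteq> 0"
    using leading_form_lookup[OF lf] by simp
  moreover have "mdegree m = (k - 1)\<^sup>2"
    using m whomog_f_poly[of k] assms by (simp add: whomog_def mdegree_eq_wt in_keys_iff)
  \<comment> \<open>The exponent is \<open>k - 1\<close> for \<open>x\<^sub>1\<close>, exactly
    \<open>2 * k - d - 1\<close> in the tied block, and
    \<open>2 * (k - i) \<le> 2 * k - 2 * d\<close> beyond it.\<close>
  moreover have "Poly_Mapping.lookup m i \<le> 2 * k - d - 1" for i
    using assms(1,2) unfolding m_def v_def lookup_add
    by (subst lookup_outer_monom) (auto simp: lookup_const_monom)
  ultimately show ?thesis
    unfolding has_monomial_bounded_def by blast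
qed

text \<open>A failing \<open>k\<close> makes \<open>k - (d - 1)\<close> a root of the coefficient
  polynomial. As \<open>d \<le> k\<close>, the subtraction does not truncate and distinct
  \<open>k\<close> give distinct roots.\<close>

lemma exceptional_bound:
  assumes "4 \<le> d"
  defines "E \<equiv> {k. d \<le> k \<and> \<not> has_monomial_bounded (f_poly k) ((k - 1)\<^sup>2) (2 * k - d - 1)}"
  shows "finite E \<and> 6 * card E \<le> (d - 3) * (d - 2) * (d - 1)"
proof -
  obtain q :: "real poly" where q: "q \<noteq> 0" "6 * degree q \<le> (d - 1 - 2) * (d - 1 - 1) * (d - 1)"
    "\<And>n. of_int (Poly_Mapping.lookup (core (d - 1) * (\<Prod>i\<in>{2..d-1}. tail_sum (d - 1) i ^ n))
       (const_monom (d - 1) 2 (n + (d - 1 - 2)))) = poly q (real n)"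
  proof -
    have "3 \<le> d - 1" using assms(1) by simp
    from core_coeff_polynomial[OF this] show ?thesis using that by blast
  qed
  define f where "f k = real (k - (d - 1))" for k
  have "f ` E \<subseteq> {x. poly q x = 0}"
    using has_monomial_bounded_f_poly[OF assms(1)] q(3) by (fastforce simp: E_def f_def simp flip: q(3))
  moreover have fin: "finite {x. poly q x = 0}" by (rule poly_roots_finite[OF q(1)])
  moreover have inj: "inj_on f E"
    using assms(1) by (auto simp: inj_on_def f_def E_def of_nat_diff)
  ultimately have "finite E" "card E \<le> card {x. poly q x = 0}"
    by (auto intro: inj_on_finite card_inj_on_le)
  moreover have "card {x. poly q x = 0} \<le> degree q"
    by (rule card_poly_roots_bound[OF q(1)])
  moreover have "d - 1 - 2 = d - 3" "d - 1 - 1 = d - 2" by auto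
  ultimately show ?thesis using q(2) by auto
qed

section \<open>Combinatorial Nullstellensatz modulo a prime\<close>

definition monom_value :: "(nat \<Rightarrow> int) \<Rightarrow> monom \<Rightarrow> int" where
  "monom_value a m = (\<Prod>i\<in>Poly_Mapping.keys m. a i ^ Poly_Mapping.lookup m i)"

definition mpoly_value :: "(nat \<Rightarrow> int) \<Rightarrow> int_mpoly \<Rightarrow> int" where
  "mpoly_value a P = (\<Sum>m\<in>Poly_Mapping.keys P. Poly_Mapping.lookup P m * monom_value a m)"

lemma monom_value_superset:
  assumes "finite A" "Poly_Mapping.keys m \<subseteq> A"
  shows "monom_value a m = (\<Prod>i\<in>A. a i ^ Poly_Mapping.lookup m i)"
  unfolding monom_value_def by (rule prod.mono_neutral_left) (use assms in \<open>auto simp: in_keys_iff\<close>)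

lemma monom_value_add: "monom_value a (m + m') = monom_value a m * monom_value a m'"
proof -
  let ?A = "Poly_Mapping.keys m \<union> Poly_Mapping.keys m'"
  have "monom_value a (m + m') = (\<Prod>i\<in>?A. a i ^ Poly_Mapping.lookup (m + m') i)"
    by (rule monom_value_superset) (auto simp: Poly_Mapping.keys_add)
  also have "\<dots> = (\<Prod>i\<in>?A. a i ^ Poly_Mapping.lookup m i) * (\<Prod>i\<in>?A. a i ^ Poly_Mapping.lookup m' i)"
    by (simp add: lookup_add power_add prod.distrib)
  finally show ?thesis
    by (simp flip: monom_value_superset)
qed

lemma mpoly_value_superset:
  assumes "finite A" "Poly_Mapping.keys P \<subseteq> A"
  shows "mpoly_value a P = (\<Sum>m\<in>A. Poly_Mapping.lookup P m * monom_value a m)"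
  unfolding mpoly_value_def by (rule sum.mono_neutral_left) (use assms in \<open>auto simp: in_keys_iff\<close>)

lemma mpoly_value_add: "mpoly_value a (P + Q) = mpoly_value a P + mpoly_value a Q"
proof -
  let ?A = "Poly_Mapping.keys P \<union> Poly_Mapping.keys Q"
  have "mpoly_value a (P + Q) = (\<Sum>m\<in>?A. Poly_Mapping.lookup (P + Q) m * monom_value a m)"
    by (rule mpoly_value_superset) (auto simp: Poly_Mapping.keys_add)
  also have "\<dots> = (\<Sum>m\<in>?A. Poly_Mapping.lookup P m * monom_value a m) +
      (\<Sum>m\<in>?A. Poly_Mapping.lookup Q m * monom_value a m)"
    by (simp add: lookup_add algebra_simps sum.distrib)
  finally show ?thesis
    by (simp flip: mpoly_value_superset)
qed

lemma mpoly_value_0 [simp]: "mpoly_value a 0 = 0"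
  by (simp add: mpoly_value_def)

lemma mpoly_value_sum: "mpoly_value a (sum f A) = (\<Sum>x\<in>A. mpoly_value a (f x))"
  by (induction A rule: infinite_finite_induct) (simp_all add: mpoly_value_add)

lemma mpoly_value_single [simp]: "mpoly_value a (Poly_Mapping.single m c) = c * monom_value a m"
  by (simp add: mpoly_value_def)

lemma mpoly_value_mult: "mpoly_value a (P * Q) = mpoly_value a P * mpoly_value a Q"
proof -
  let ?lP = "Poly_Mapping.lookup P" and ?lQ = "Poly_Mapping.lookup Q"
  have "P * Q = (\<Sum>m\<in>Poly_Mapping.keys P. Poly_Mapping.single m (?lP m)) *
      (\<Sum>m\<in>Poly_Mapping.keys Q. Poly_Mapping.single m (?lQ m))"
    by (simp flip: mpoly_expand)
  also have "\<dots> = (\<Sum>m\<in>Poly_Mapping.keys P. \<Sum>m'\<in>Poly_Mapping.keys Q.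
      Poly_Mapping.single (m + m') (?lP m * ?lQ m'))"
    by (simp add: sum_product mult_single)
  finally have "mpoly_value a (P * Q) = (\<Sum>m\<in>Poly_Mapping.keys P. \<Sum>m'\<in>Poly_Mapping.keys Q.
      ?lP m * ?lQ m' * (monom_value a m * monom_value a m'))"
    by (simp only: mpoly_value_sum mpoly_value_single monom_value_add)
  thus ?thesis
    by (simp add: mpoly_value_def[of a P] mpoly_value_def[of a Q] sum_product mult_ac)
qed

lemma mpoly_value_1 [simp]: "mpoly_value a 1 = 1"
  by (simp add: mpoly_value_def monom_value_def)

lemma mpoly_value_prod: "mpoly_value a (prod f A) = (\<Prod>x\<in>A. mpoly_value a (f x))"
  by (induction A rule: infinite_finite_induct) (simp_all add: mpoly_value_mult)

lemma mpoly_value_diff: "mpoly_value a (P - Q) = mpoly_value a P - mpoly_value a Q"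
  using mpoly_value_add[of a "P - Q" Q] by simp

lemma mpoly_value_var [simp]: "mpoly_value a (var i) = a i"
  by (simp add: var_def monom_value_def)

text \<open>
  The weights are those of a divided difference, cleared of denominators so that they live over the
  integers. In the induction step the new functional is \<open>f \<mapsto> L ((f - f t) / (x - t))\<close>, scaled by
  \<open>\<Prod>r\<in>T. r - t\<close>.
\<close>

lemma extraction_weights:
  fixes S :: "int set" and p :: int
  assumes "finite S" "card S = Suc m" "prime p"
    and "\<And>x y. x \<in> S \<Longrightarrow> y \<in> S \<Longrightarrow> x \<noteq> y \<Longrightarrow> \<not> p dvd x - y"
  shows "\<exists>c D. \<not> p dvd D \<and> (\<Sum>s\<in>S. c s * s ^ m) = D \<and> (\<forall>e<m. (\<Sum>s\<in>S. c s * s ^ e) = 0)"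
  using assms
proof (induction m arbitrary: S)
  case 0
  then obtain s where "S = {s}" by (auto simp: card_Suc_eq)
  thus ?case using not_prime_unit[of p] \<open>prime p\<close>
    by (intro exI[of _ "\<lambda>_. 1"] exI[of _ 1]) auto
next
  case (Suc m)
  then obtain t T where T: "S = insert t T" "t \<notin> T" "card T = Suc m" "finite T"
    by (metis card_Suc_eq finite_insert)
  obtain c D where c: "\<not> p dvd D" "(\<Sum>s\<in>T. c s * s ^ m) = D" "\<And>e. e < m \<Longrightarrow> (\<Sum>s\<in>T. c s * s ^ e) = 0"
    using Suc.IH[of T] Suc.prems T by blast
  define R where "R = (\<Prod>r\<in>T. r - t)"
  \<comment> \<open>The weight at \<open>t\<close> is minus the sum of the others, so only
    \<open>f - f t\<close> is seen. Omitting \<open>s\<close> from the product \<open>R\<close>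
    amounts to dividing by \<open>s - t\<close>.\<close>
  define c' where "c' s = (if s = t then - (\<Sum>s\<in>T. c s * (\<Prod>r\<in>T - {s}. r - t))
      else c s * (\<Prod>r\<in>T - {s}. r - t))" for s
  have c'_T: "(\<Sum>s\<in>T. c' s * f s) = (\<Sum>s\<in>T. c s * (\<Prod>r\<in>T - {s}. r - t) * f s)" for f
    using T by (intro sum.cong) (auto simp: c'_def)
  \<comment> \<open>For \<open>e \<le> m\<close> the old weights kill every term on the right. For
    \<open>e = Suc m\<close> only \<open>i = m\<close> survives, with coefficient 1.\<close>
  have c'_sum: "(\<Sum>s\<in>S. c' s * s ^ e) = R * (\<Sum>i<e. t ^ (e - Suc i) * (\<Sum>s\<in>T. c s * s ^ i))" for e
  proof -
    have "(\<Sum>s\<in>S. c' s * s ^ e) = (\<Sum>s\<in>T. c s * (\<Prod>r\<in>T - {s}. r - t) * (s ^ e - t ^ e))"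
      using T by (simp add: c'_T) (simp add: c'_def sum_distrib_right right_diff_distrib sum_subtractf)
    also have "\<dots> = (\<Sum>s\<in>T. R * (c s * (\<Sum>i<e. t ^ (e - Suc i) * s ^ i)))"
    proof (rule sum.cong)
      fix s assume "s \<in> T"
      hence "R = (s - t) * (\<Prod>r\<in>T - {s}. r - t)"
        using T by (simp add: R_def prod.remove)
      thus "c s * (\<Prod>r\<in>T - {s}. r - t) * (s ^ e - t ^ e) = R * (c s * (\<Sum>i<e. t ^ (e - Suc i) * s ^ i))"
        by (simp add: power_diff_sumr2)
    qed simp
    also have "\<dots> = R * (\<Sum>i<e. t ^ (e - Suc i) * (\<Sum>s\<in>T. c s * s ^ i))"
      by (simp add: sum_distrib_left mult_ac) (subst sum.swap, simp add: mult_ac)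
    finally show ?thesis .
  qed
  have "\<not> p dvd R"
    using \<open>prime p\<close> T Suc.prems(4) unfolding R_def by (subst prime_dvd_prod_iff) auto
  hence "\<not> p dvd R * D"
    using c(1) \<open>prime p\<close> by (simp add: prime_dvd_mult_iff)
  moreover have "(\<Sum>s\<in>S. c' s * s ^ Suc m) = R * D"
    unfolding c'_sum using c(2,3) by simp
  moreover have "(\<Sum>s\<in>S. c' s * s ^ e) = 0" if "e < Suc m" for e
    unfolding c'_sum using c(3) that by simp
  ultimately show ?case by blast
qed

text \<open>The product of the one-variable functionals is applied to \<open>P\<close>. A monomial
  other than \<open>m\<close>, of degree at most that of \<open>m\<close>, has a smaller exponent
  somewhere and is annihilated. What remains is the coefficient of \<open>m\<close> times factors
  prime to \<open>p\<close>.\<close>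

lemma combinatorial_nullstellensatz_mod:
  fixes p :: int and P :: int_mpoly
  assumes "prime p" "finite S"
    and S: "\<And>x y. x \<in> S \<Longrightarrow> y \<in> S \<Longrightarrow> x \<noteq> y \<Longrightarrow> \<not> p dvd x - y"
    and deg: "\<And>m'. m' \<in> Poly_Mapping.keys P \<Longrightarrow> mdegree m' \<le> mdegree m"
    and coeff: "\<not> p dvd Poly_Mapping.lookup P m"
    and card: "\<And>i. Poly_Mapping.lookup m i < card S"
  shows "\<exists>a. range a \<subseteq> S \<and> \<not> p dvd mpoly_value a P"
proof -
  obtain s0 where s0: "s0 \<in> S" using card[of 0] by fastforce
  define V where "V = Poly_Mapping.keys m \<union> (\<Union>m'\<in>Poly_Mapping.keys P. Poly_Mapping.keys m')"
  have [simp]: "finite V" by (auto simp: V_def)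
  have "\<exists>T c. T \<subseteq> S \<and> \<not> p dvd (\<Sum>s\<in>T. c s * s ^ Poly_Mapping.lookup m i) \<and>
     (\<forall>e < Poly_Mapping.lookup m i. (\<Sum>s\<in>T. c s * s ^ e) = 0)" for i
  proof -
    \<comment> \<open>The extraction weights need exactly one point more than the exponent, so
      \<open>S\<close> is cut down for each variable.\<close>
    obtain T where "T \<subseteq> S" "card T = Suc (Poly_Mapping.lookup m i)" "finite T"
      using obtain_subset_with_card_n[of "Suc (Poly_Mapping.lookup m i)" S] card[of i] by (metis Suc_leI)
    moreover from this have "\<exists>c D. \<not> p dvd D \<and> (\<Sum>s\<in>T. c s * s ^ Poly_Mapping.lookup m i) = D \<and>
        (\<forall>e<Poly_Mapping.lookup m i. (\<Sum>s\<in>T. c s * s ^ e) = 0)"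
      by (intro extraction_weights) (use assms(1) S in auto)
    ultimately show ?thesis by auto
  qed
  then obtain T c where T: "\<And>i. T i \<subseteq> S"
    and lead: "\<And>i. \<not> p dvd (\<Sum>s\<in>T i. c i s * s ^ Poly_Mapping.lookup m i)"
    and vanish: "\<And>i e. e < Poly_Mapping.lookup m i \<Longrightarrow> (\<Sum>s\<in>T i. c i s * s ^ e) = 0"
    by metis
  define A where "A = (\<Pi>\<^sub>E i\<in>V. T i)"
  have finT: "finite (T i)" for i using T assms(2) finite_subset by blast
  have sum_monom: "(\<Sum>a\<in>A. (\<Prod>i\<in>V. c i (a i)) * monom_value a m') =
      (\<Prod>i\<in>V. \<Sum>s\<in>T i. c i s * s ^ Poly_Mapping.lookup m' i)" if "Poly_Mapping.keys m' \<subseteq> V" for m'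
    unfolding A_def using that finT
    by (simp add: prod_sum_PiE prod.distrib monom_value_superset[of V])
  have other: "(\<Prod>i\<in>V. \<Sum>s\<in>T i. c i s * s ^ Poly_Mapping.lookup m' i) = 0"
    if m': "m' \<in> Poly_Mapping.keys P" "m' \<noteq> m" for m'
  proof -
    have sub: "Poly_Mapping.keys m' \<subseteq> V" "Poly_Mapping.keys m \<subseteq> V" using m' by (auto simp: V_def)
    have "\<exists>i\<in>V. Poly_Mapping.lookup m' i < Poly_Mapping.lookup m i"
    proof (rule ccontr)
      assume "\<not> ?thesis"
      hence ge: "Poly_Mapping.lookup m i \<le> Poly_Mapping.lookup m' i" if "i \<in> V" for i
        using that by force
      obtain j where j: "Poly_Mapping.lookup m' j \<noteq> Poly_Mapping.lookup m j"
        using m'(2) by (metis poly_mapping_eqI)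
      hence "j \<in> V" using sub by (metis in_keys_iff subsetD)
      hence "(\<Sum>i\<in>V. Poly_Mapping.lookup m i) < (\<Sum>i\<in>V. Poly_Mapping.lookup m' i)"
        using ge j by (intro sum_strict_mono_ex1) (auto simp: less_le intro!: bexI[of _ j])
      moreover have "(\<Sum>i\<in>V. Poly_Mapping.lookup m' i) = mdegree m'"
        "(\<Sum>i\<in>V. Poly_Mapping.lookup m i) = mdegree m"
        using sub by (simp_all add: mdegree_eq_wt wt_superset[of V])
      ultimately show False using deg[OF m'(1)] by linarith
    qed
    thus ?thesis using vanish by (intro prod_zero) auto
  qed
  have m_in: "m \<in> Poly_Mapping.keys P" using coeff by (auto simp: in_keys_iff)
  have "(\<Sum>a\<in>A. (\<Prod>i\<in>V. c i (a i)) * mpoly_value a P) =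
     (\<Sum>m'\<in>Poly_Mapping.keys P. Poly_Mapping.lookup P m' * (\<Sum>a\<in>A. (\<Prod>i\<in>V. c i (a i)) * monom_value a m'))"
    unfolding mpoly_value_def sum_distrib_left by (subst sum.swap) (simp add: mult_ac)
  also have "\<dots> = (\<Sum>m'\<in>Poly_Mapping.keys P. if m' = m then
      Poly_Mapping.lookup P m * (\<Prod>i\<in>V. \<Sum>s\<in>T i. c i s * s ^ Poly_Mapping.lookup m i) else 0)"
  proof (rule sum.cong)
    fix m' assume "m' \<in> Poly_Mapping.keys P"
    moreover from this have "Poly_Mapping.keys m' \<subseteq> V" by (auto simp: V_def)
    ultimately show "Poly_Mapping.lookup P m' * (\<Sum>a\<in>A. (\<Prod>i\<in>V. c i (a i)) * monom_value a m') =
      (if m' = m then Poly_Mapping.lookup P m * (\<Prod>i\<in>V. \<Sum>s\<in>T i. c i s * s ^ Poly_Mapping.lookup m i) else 0)"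
      using other by (simp add: sum_monom)
  qed simp
  also have "\<dots> = Poly_Mapping.lookup P m * (\<Prod>i\<in>V. \<Sum>s\<in>T i. c i s * s ^ Poly_Mapping.lookup m i)"
    using m_in by simp
  finally have "\<not> p dvd (\<Sum>a\<in>A. (\<Prod>i\<in>V. c i (a i)) * mpoly_value a P)"
    using coeff lead assms(1) by (auto simp: prime_dvd_mult_iff prime_dvd_prod_iff)
  then obtain a where a: "a \<in> A" "\<not> p dvd mpoly_value a P"
    by (meson dvd_mult dvd_sum)
  \<comment> \<open>The value \<open>s0\<close> outside \<open>V\<close> keeps the whole range in
    \<open>S\<close>; those variables do not occur in \<open>P\<close>.\<close>
  define b where "b i = (if i \<in> V then a i else s0)" for i
  have "mpoly_value b P = mpoly_value a P"
    unfolding mpoly_value_def monom_value_def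
    by (intro sum.cong prod.cong arg_cong2[where f = "(*)"] refl) (auto simp: b_def V_def)
  moreover have "range b \<subseteq> S"
    using a(1) T s0 by (auto simp: b_def A_def)
  ultimately show ?thesis using a(2) by metis
qed

section \<open>From a nonzero value of \<open>f_poly k\<close> to distinct partial sums\<close>

lemma prime_dvd_mpoly_value_f_poly:
  assumes "prime p" "\<not> p dvd mpoly_value a (f_poly k)"
  shows "\<And>i j. 1 \<le> i \<Longrightarrow> i < j \<Longrightarrow> j \<le> k \<Longrightarrow> \<not> p dvd a j - a i"
    and "\<And>i j. 2 \<le> i \<Longrightarrow> i < j \<Longrightarrow> j \<le> k \<Longrightarrow> \<not> p dvd (\<Sum>l\<in>{i..j}. a l)"
proof -
  have "mpoly_value a (f_poly k) =
     (\<Prod>(i, j)\<in>pairs 1 k. a j - a i) * (\<Prod>(i, j)\<in>pairs 2 k. \<Sum>l\<in>{i..j}. a l)"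
    unfolding f_poly_def mpoly_value_mult mpoly_value_prod
    by (simp add: case_prod_unfold mpoly_value_diff mpoly_value_sum)
  hence nd: "\<not> p dvd (\<Prod>(i, j)\<in>pairs 1 k. a j - a i)" "\<not> p dvd (\<Prod>(i, j)\<in>pairs 2 k. \<Sum>l\<in>{i..j}. a l)"
    using assms(2) by auto
  show "\<not> p dvd a j - a i" if "1 \<le> i" "i < j" "j \<le> k" for i j
  proof -
    have "a j - a i dvd (\<Prod>(i, j)\<in>pairs 1 k. a j - a i)"
      using dvd_prodI[OF finite_pairs, of "(i, j)" 1 k "\<lambda>(i, j). a j - a i"] that by simp
    thus ?thesis using nd(1) dvd_trans by blast
  qed
  show "\<not> p dvd (\<Sum>l\<in>{i..j}. a l)" if "2 \<le> i" "i < j" "j \<le> k" for i j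
  proof -
    have "(\<Sum>l\<in>{i..j}. a l) dvd (\<Prod>(i, j)\<in>pairs 2 k. \<Sum>l\<in>{i..j}. a l)"
      using dvd_prodI[OF finite_pairs, of "(i, j)" 2 k "\<lambda>(i, j). \<Sum>l\<in>{i..j}. a l"] that by simp
    thus ?thesis using nd(2) dvd_trans by blast
  qed
qed

text \<open>The difference of two partial sums is \<open>a (Suc i) + ... + a j\<close> with
  \<open>Suc i \<ge> 2\<close>. With at least two terms it is the value of a factor of
  \<open>f_poly k\<close>; a single term is nonzero modulo \<open>p\<close> because \<open>S\<close>
  avoids 0.\<close>

lemma admits_distinct_partial_sums_of_value:
  assumes "prime p" "S \<subseteq> {0<..<int p}" "a ` {1..k} \<subseteq> S"
    and "\<not> int p dvd mpoly_value a (f_poly k)"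
  shows "admits_distinct_partial_sums p k S"
proof -
  have p: "prime (int p)" "int p > 1" using assms(1) prime_gt_1_nat[of p] by auto
  interpret residues "int p" "residue_ring (int p)" by unfold_locales (use p in auto)
  note nd = prime_dvd_mpoly_value_f_poly[OF p(1) assms(4)]
  have sum_eq: "(\<Oplus>\<^bsub>residue_ring (int p)\<^esub>i\<in>{1..j}. a i) = (\<Sum>i\<in>{1..j}. a i) mod int p" if "j \<le> k" for j
  proof -
    have a: "a i = a i mod int p" if "i \<in> {1..j}" for i
      using that \<open>j \<le> k\<close> assms(2,3) by (subst mod_pos_pos_trivial) (force simp: image_subset_iff)+
    have "(\<Oplus>\<^bsub>residue_ring (int p)\<^esub>i\<in>{1..j}. a i) = (\<Oplus>\<^bsub>residue_ring (int p)\<^esub>i\<in>{1..j}. a i mod int p)"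
      by (rule finsum_cong') (use a in \<open>auto intro: mod_in_carrier\<close>)
    thus ?thesis by (simp add: sum_cong)
  qed
  have "inj_on a {1..k}"
    by (rule linorder_inj_onI) (use nd(1) in force)+
  moreover have "inj_on (\<lambda>j. \<Oplus>\<^bsub>residue_ring (int p)\<^esub>i\<in>{1..j}. a i) {1..k}"
  proof (rule linorder_inj_onI)
    fix i j assume ij: "i < j" "i \<in> {1..k}" "j \<in> {1..k}"
    have "(\<Sum>l\<in>{1..j}. a l) - (\<Sum>l\<in>{1..i}. a l) = (\<Sum>l\<in>{Suc i..j}. a l)"
      using ij sum.ub_add_nat[of 1 i a "j - i"] by simp
    moreover have "\<not> int p dvd (\<Sum>l\<in>{Suc i..j}. a l)"
    proof (cases "j = Suc i")
      case True
      have "a j \<in> S" using assms(3) ij by auto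
      hence "0 < a j" "a j < int p" using assms(2) by auto
      thus ?thesis using True zdvd_not_zless by simp
    qed (use ij nd(2) in auto)
    ultimately have "(\<Sum>l\<in>{1..j}. a l) mod int p \<noteq> (\<Sum>l\<in>{1..i}. a l) mod int p"
      by (metis mod_eq_dvd_iff)
    thus "(\<Oplus>\<^bsub>residue_ring (int p)\<^esub>l\<in>{1..i}. a l) \<noteq> (\<Oplus>\<^bsub>residue_ring (int p)\<^esub>l\<in>{1..j}. a l)"
      using ij sum_eq[of i] sum_eq[of j] by simp
  qed auto
  ultimately show ?thesis
    unfolding admits_distinct_partial_sums_def using assms(3) by blast
qed

theorem theorem3p2:
  fixes d :: nat
  assumes "d > 3"
  defines "E \<equiv> {k :: nat. real k > max (real d - 1) ((real d)\<^sup>2 / 8) \<and>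
                    \<not> has_monomial_bounded (f_poly k) ((k - 1)\<^sup>2) (2 * k - d - 1)}"
  shows "(\<forall>k\<ge>2. homogeneous_of_degree ((k - 1)\<^sup>2) (f_poly k)) \<and>
    (finite E \<and> real (card E) \<le> (real d - 3) * (real d - 2) * (real d - 1) / 6) \<and>
    (\<forall>k :: nat. real k > max (real d - 1) ((real d)\<^sup>2 / 8) \<and> k \<notin> E \<longrightarrow>
       (\<exists>P :: nat set. finite P \<and> (\<forall>q\<in>P. prime q) \<and>
          (\<forall>p :: nat. prime p \<and> p \<notin> P \<longrightarrow>
             (\<forall>S. S \<subseteq> carrier (residue_ring (int p)) - {\<zero>\<^bsub>residue_ring (int p)\<^esub>} \<and>
                  card S = 2 * k - d \<longrightarrow>
                  admits_distinct_partial_sums p k S))))"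
proof (intro conjI allI impI)
  fix k :: nat assume "2 \<le> k"
  thus "homogeneous_of_degree ((k - 1)\<^sup>2) (f_poly k)"
    by (intro homogeneous_f_poly) simp
next
  let ?E = "{k. d \<le> k \<and> \<not> has_monomial_bounded (f_poly k) ((k - 1)\<^sup>2) (2 * k - d - 1)}"
  have bound: "finite ?E" "6 * card ?E \<le> (d - 3) * (d - 2) * (d - 1)"
    using exceptional_bound[of d] assms(1) by auto
  have "E \<subseteq> ?E" by (auto simp: E_def)
  thus "finite E" using bound(1) finite_subset by blast
  have "card E \<le> card ?E" by (rule card_mono) fact+
  hence "real (6 * card E) \<le> real ((d - 3) * (d - 2) * (d - 1))"
    using bound(2) by linarith
  thus "real (card E) \<le> (real d - 3) * (real d - 2) * (real d - 1) / 6"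
    using assms(1) by (simp add: of_nat_diff)
next
  fix k :: nat assume "real k > max (real d - 1) ((real d)\<^sup>2 / 8) \<and> k \<notin> E"
  hence k: "d \<le> k" and "has_monomial_bounded (f_poly k) ((k - 1)\<^sup>2) (2 * k - d - 1)"
    by (auto simp: E_def)
  then obtain m where m: "mdegree m = (k - 1)\<^sup>2" "Poly_Mapping.lookup (f_poly k) m \<noteq> 0"
    "\<And>i. Poly_Mapping.lookup m i \<le> 2 * k - d - 1"
    by (auto simp: has_monomial_bounded_def)
  define c where "c = Poly_Mapping.lookup (f_poly k) m"
  \<comment> \<open>The excluded primes divide a nonzero integer, hence are bounded by its absolute
    value.\<close>
  define P where "P = {q :: nat. prime q \<and> int q dvd c}"
  have "P \<subseteq> {..nat \<bar>c\<bar>}"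
  proof
    fix q assume "q \<in> P"
    hence "int q dvd \<bar>c\<bar>" by (simp add: P_def)
    hence "int q \<le> \<bar>c\<bar>" using m(2) by (intro zdvd_imp_le) (auto simp: c_def)
    thus "q \<in> {..nat \<bar>c\<bar>}" by simp
  qed
  hence "finite P" by (rule finite_subset) simp
  moreover have "admits_distinct_partial_sums p k S" if p: "prime p" "p \<notin> P"
    and S: "S \<subseteq> carrier (residue_ring (int p)) - {\<zero>\<^bsub>residue_ring (int p)\<^esub>}" "card S = 2 * k - d" for p S
  proof -
    have S': "S \<subseteq> {0<..<int p}"
      using S(1) by (auto simp: residue_ring_def)
    have "\<exists>a. range a \<subseteq> S \<and> \<not> int p dvd mpoly_value a (f_poly k)"
    proof (rule combinatorial_nullstellensatz_mod)
      show "prime (int p)" using p by simp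
      show "finite S" using S' finite_subset by blast
      show "\<not> int p dvd x - y" if "x \<in> S" "y \<in> S" "x \<noteq> y" for x y
      proof
        assume "int p dvd x - y"
        hence "x mod int p = y mod int p" by (simp add: mod_eq_dvd_iff)
        moreover have "x mod int p = x" "y mod int p = y"
          using that S' by (auto intro!: mod_pos_pos_trivial simp: subset_iff less_imp_le)
        ultimately show False using that by simp
      qed
      show "mdegree m' \<le> mdegree m" if "m' \<in> Poly_Mapping.keys (f_poly k)" for m'
        using that homogeneous_f_poly[of k] m(1) k assms(1) by (simp add: homogeneous_of_degree_def)
      show "\<not> int p dvd Poly_Mapping.lookup (f_poly k) m"
        using p by (auto simp: P_def c_def)
      \<comment> \<open>Since \<open>k \<ge> d > 3\<close>, the bound \<open>2 * k - d - 1\<close>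
        is not truncated and lies one below \<open>card S\<close>.\<close>
      show "Poly_Mapping.lookup m i < card S" for i
        using m(3)[of i] S(2) k assms(1) by linarith
    qed
    then obtain a where "range a \<subseteq> S" "\<not> int p dvd mpoly_value a (f_poly k)" by blast
    thus ?thesis
      using p(1) S' by (intro admits_distinct_partial_sums_of_value[of p S a]) auto
  qed
  ultimately show "\<exists>P :: nat set. finite P \<and> (\<forall>q\<in>P. prime q) \<and>
      (\<forall>p :: nat. prime p \<and> p \<notin> P \<longrightarrow>
         (\<forall>S. S \<subseteq> carrier (residue_ring (int p)) - {\<zero>\<^bsub>residue_ring (int p)\<^esub>} \<and>
              card S = 2 * k - d \<longrightarrow> admits_distinct_partial_sums p k S))"
    by (intro exI[of _ P]) (auto simp: P_def)
qed

end
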